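(* Let $R>0$. A circle of radius $R$, i.e. $\vartheta(\alpha,t)=\widehat\vartheta(0)$ constant (in $\alpha$ and in time) and $L(t)=2\pi R$, is a time-independent solution of the system $$\vartheta_t(\alpha)=\frac{2\pi}{L(t)}U_\alpha(\alpha)+\frac{2\pi}{L(t)}T(\alpha)(1+\vartheta_\alpha(\alpha)),\qquad L_t(t)=-\int_{-\pi}^{\pi}(1+\vartheta_\alpha(\alpha))U(\alpha)\,d\alpha,$$ with $U$ and $T$ as defined in the context and $T(0)=A_\rho\sin\widehat\vartheta(0)$. It corresponds to the solution of the contour equation $z_t(\alpha)=U(\alpha)n(\alpha)+T(\alpha)\tau(\alpha)$ given by a circle of radius $R$ moving vertically with velocity $A_\rho$ (i.e. $z_t(\alpha,t)=iA_\rho$).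
   Context: The interface between two fluids is a closed curve $z(\alpha,t)\in\mathbb C\simeq\mathbb R^2$, $\alpha\in[-\pi,\pi]$, with tangent $z_\alpha(\alpha,t)=\frac{L(t)}{2\pi}e^{i(\alpha+\vartheta(\alpha,t))}$, where $L(t)$ is its length and $\vartheta$ is real and $2\pi$-periodic. $\widehat\vartheta(0)=\frac1{2\pi}\int_{-\pi}^{\pi}\vartheta\,d\alpha$. Unit tangent and normal: $\tau(\alpha)=e^{i(\alpha+\vartheta(\alpha))}$, $n(\alpha)=ie^{i(\alpha+\vartheta(\alpha))}$. Parameters: $A_\mu\in[-1,1]$, $A_\rho\in\mathbb R$, $A_\sigma>0$. Definitions (time suppressed): $$\overline{BR}(\omega)(\alpha)=\frac{1}{iL(t)}\mathrm{pv}\int_{-\pi}^{\pi}\frac{\omega(\alpha-\beta)}{\int_0^1e^{i(\alpha+(s-1)\beta)}e^{i\vartheta(\alpha+(s-1)\beta)}ds}\frac{d\beta}{\beta},$$ $$U(\alpha)=\mathrm{Re}\big(\overline{BR}(\omega)(\alpha)\,ie^{i(\alpha+\vartheta(\alpha))}\big),$$ where the real function $\omega$ (vorticity strength) solves $$\omega(\alpha)=-2A_\mu\frac{L(t)}{2\pi}\mathrm{Re}\big(\overline{BR}(\omega)(\alpha)e^{i(\alpha+\vartheta(\alpha))}\big)+2A_\sigma\frac{2\pi}{L(t)}\vartheta_{\alpha\alpha}(\alpha)-2A_\rho\frac{L(t)}{2\pi}\sin(\alpha+\vartheta(\alpha)),$$ and $$T(\alpha)=\int_0^\alpha(1+\vartheta_\alpha(\eta))U(\eta)d\eta-\frac{\alpha}{2\pi}\int_{-\pi}^{\pi}(1+\vartheta_\alpha(\eta))U(\eta)d\eta+T(0).$$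 *)

theory Defs
  imports "HOL-Analysis.Analysis"
begin

text \<open>
  The interface at a fixed time is described by its length \<open>L\<close> and the function \<open>\<theta>\<close>, through
  \<open>z\<^sub>\<alpha> = L/(2\<pi>) cis (\<alpha> + \<theta> \<alpha>)\<close>. Functions of \<open>\<alpha> \<in> [-\<pi>,\<pi>]\<close> are represented by
  \<open>2\<pi>\<close>-periodic functions on the real line. Time-dependent quantities take time as their first
  argument, so that \<open>\<theta> t\<close> is a function of \<open>\<alpha>\<close>.
\<close>

definition periodic_2pi :: "(real \<Rightarrow> 'a) \<Rightarrow> bool" where
  "periodic_2pi f \<longleftrightarrow> (\<forall>x. f (x + 2 * pi) = f x)"

definition mean_value :: "(real \<Rightarrow> real) \<Rightarrow> real" where
  "mean_value f = 1 / (2 * pi) * (LBINT \<alpha>=-pi..pi. f \<alpha>)"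

text \<open>Principal value on \<open>[-\<pi>,\<pi>]\<close> with singularity at \<open>0\<close>.\<close>

definition has_pv_integral :: "(real \<Rightarrow> complex) \<Rightarrow> complex \<Rightarrow> bool" where
  "has_pv_integral f I \<longleftrightarrow>
     (\<forall>\<epsilon>. 0 < \<epsilon> \<and> \<epsilon> < pi \<longrightarrow> set_integrable lborel ({-pi..-\<epsilon>} \<union> {\<epsilon>..pi}) f) \<and>
     ((\<lambda>\<epsilon>. set_lebesgue_integral lborel ({-pi..-\<epsilon>} \<union> {\<epsilon>..pi}) f) \<longlongrightarrow> I) (at_right 0)"

definition pv_integral :: "(real \<Rightarrow> complex) \<Rightarrow> complex" where
  "pv_integral f = (THE I. has_pv_integral f I)"

text \<open>\<open>chord \<theta> \<alpha> \<beta>\<close> equals \<open>(2\<pi>/L) (z \<alpha> - z (\<alpha> - \<beta>)) / \<beta>\<close> for \<open>\<beta> \<noteq> 0\<close>.\<close>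

definition chord :: "(real \<Rightarrow> real) \<Rightarrow> real \<Rightarrow> real \<Rightarrow> complex" where
  "chord \<theta> \<alpha> \<beta> = (LBINT s=0..1. cis (\<alpha> + (s - 1) * \<beta>) * cis (\<theta> (\<alpha> + (s - 1) * \<beta>)))"

definition BR_integrand ::
  "(real \<Rightarrow> real) \<Rightarrow> (real \<Rightarrow> real) \<Rightarrow> real \<Rightarrow> real \<Rightarrow> complex" where
  "BR_integrand \<theta> \<omega> \<alpha> \<beta> =
     complex_of_real (\<omega> (\<alpha> - \<beta>)) / chord \<theta> \<alpha> \<beta> * (1 / complex_of_real \<beta>)"

text \<open>The complex conjugate of the Birkhoff--Rott integral.\<close>

definition BR_conj :: "real \<Rightarrow> (real \<Rightarrow> real) \<Rightarrow> (real \<Rightarrow> real) \<Rightarrow> real \<Rightarrow> complex" where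
  "BR_conj L \<theta> \<omega> \<alpha> = 1 / (\<i> * complex_of_real L) * pv_integral (BR_integrand \<theta> \<omega> \<alpha>)"

definition unit_tangent :: "(real \<Rightarrow> real) \<Rightarrow> real \<Rightarrow> complex" where
  "unit_tangent \<theta> \<alpha> = cis (\<alpha> + \<theta> \<alpha>)"

definition unit_normal :: "(real \<Rightarrow> real) \<Rightarrow> real \<Rightarrow> complex" where
  "unit_normal \<theta> \<alpha> = \<i> * cis (\<alpha> + \<theta> \<alpha>)"

definition normal_velocity :: "real \<Rightarrow> (real \<Rightarrow> real) \<Rightarrow> (real \<Rightarrow> real) \<Rightarrow> real \<Rightarrow> real" where
  "normal_velocity L \<theta> \<omega> \<alpha> = Re (BR_conj L \<theta> \<omega> \<alpha> * (\<i> * cis (\<alpha> + \<theta> \<alpha>)))"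

text \<open>
  The function \<open>\<omega>\<close> is a vorticity strength for \<open>(L, \<theta>)\<close>. Convergence of the principal value is
  part of the notion, so the equation never involves an undefined value of \<open>pv_integral\<close>.
  No uniqueness is built in: for instance, if \<open>A\<^sub>\<mu> = -1\<close> and the interface is a circle, \<open>\<omega>\<close> is
  determined only up to an additive constant.
\<close>

definition is_vorticity ::
  "real \<Rightarrow> real \<Rightarrow> real \<Rightarrow> real \<Rightarrow> (real \<Rightarrow> real) \<Rightarrow> (real \<Rightarrow> real) \<Rightarrow> bool" where
  "is_vorticity A\<^sub>\<mu> A\<^sub>\<sigma> A\<^sub>\<rho> L \<theta> \<omega> \<longleftrightarrow>
     periodic_2pi \<omega> \<and>
     (\<forall>\<alpha>. \<exists>I. has_pv_integral (BR_integrand \<theta> \<omega> \<alpha>) I) \<and>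
     (\<forall>\<alpha>. \<omega> \<alpha> =
        - 2 * A\<^sub>\<mu> * (L / (2 * pi)) * Re (BR_conj L \<theta> \<omega> \<alpha> * cis (\<alpha> + \<theta> \<alpha>))
        + 2 * A\<^sub>\<sigma> * (2 * pi / L) * deriv (deriv \<theta>) \<alpha>
        - 2 * A\<^sub>\<rho> * (L / (2 * pi)) * sin (\<alpha> + \<theta> \<alpha>))"

definition tangential_velocity ::
  "real \<Rightarrow> (real \<Rightarrow> real) \<Rightarrow> (real \<Rightarrow> real) \<Rightarrow> real \<Rightarrow> real \<Rightarrow> real" where
  "tangential_velocity L \<theta> \<omega> T0 \<alpha> =
     (LBINT \<eta>=0..\<alpha>. (1 + deriv \<theta> \<eta>) * normal_velocity L \<theta> \<omega> \<eta>)
     - \<alpha> / (2 * pi) * (LBINT \<eta>=-pi..pi. (1 + deriv \<theta> \<eta>) * normal_velocity L \<theta> \<omega> \<eta>)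
     + T0"

text \<open>
  Shape conditions under which the quantities above are meaningful: \<open>\<theta>\<close> is periodic and twice
  differentiable, and the curve is closed and does not meet itself (so that \<open>chord\<close>, which
  occurs as a denominator, does not vanish).
\<close>

definition admissible_shape :: "real \<Rightarrow> (real \<Rightarrow> real) \<Rightarrow> bool" where
  "admissible_shape L \<theta> \<longleftrightarrow>
     L > 0 \<and> periodic_2pi \<theta> \<and>
     (\<forall>\<alpha>. \<theta> field_differentiable at \<alpha>) \<and> (\<forall>\<alpha>. deriv \<theta> field_differentiable at \<alpha>) \<and>
     (LBINT \<alpha>=-pi..pi. cis (\<alpha> + \<theta> \<alpha>)) = 0 \<and>
     (\<forall>\<alpha>. \<forall>\<beta>\<in>{-pi..pi}. chord \<theta> \<alpha> \<beta> \<noteq> 0)"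

text \<open>
  Solutions on a time interval \<open>J\<close> of the evolution system for \<open>(\<theta>, L)\<close>, with vorticity strength
  \<open>\<omega> t\<close> and prescribed value \<open>T0 t\<close> of the tangential velocity at \<open>\<alpha> = 0\<close>.
\<close>

definition theta_L_solution ::
  "real set \<Rightarrow> real \<Rightarrow> real \<Rightarrow> real \<Rightarrow> (real \<Rightarrow> real) \<Rightarrow>
   (real \<Rightarrow> real \<Rightarrow> real) \<Rightarrow> (real \<Rightarrow> real) \<Rightarrow> (real \<Rightarrow> real \<Rightarrow> real) \<Rightarrow> bool" where
  "theta_L_solution J A\<^sub>\<mu> A\<^sub>\<sigma> A\<^sub>\<rho> T0 \<theta> L \<omega> \<longleftrightarrow>
     (\<forall>t\<in>J.
        admissible_shape (L t) (\<theta> t) \<and>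
        is_vorticity A\<^sub>\<mu> A\<^sub>\<sigma> A\<^sub>\<rho> (L t) (\<theta> t) (\<omega> t) \<and>
        (\<forall>\<alpha>. normal_velocity (L t) (\<theta> t) (\<omega> t) field_differentiable at \<alpha>) \<and>
        set_integrable lborel {-pi..pi}
          (\<lambda>\<eta>. (1 + deriv (\<theta> t) \<eta>) * normal_velocity (L t) (\<theta> t) (\<omega> t) \<eta>) \<and>
        (\<forall>\<alpha>. ((\<lambda>s. \<theta> s \<alpha>) has_real_derivative
                (2 * pi / L t * deriv (normal_velocity (L t) (\<theta> t) (\<omega> t)) \<alpha>
                 + 2 * pi / L t * tangential_velocity (L t) (\<theta> t) (\<omega> t) (T0 t) \<alpha>
                   * (1 + deriv (\<theta> t) \<alpha>)))
              (at t within J)) \<and>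
        (L has_real_derivative
           - (LBINT \<alpha>=-pi..pi. (1 + deriv (\<theta> t) \<alpha>) * normal_velocity (L t) (\<theta> t) (\<omega> t) \<alpha>))
          (at t within J))"

definition closed_contour ::
  "real set \<Rightarrow> (real \<Rightarrow> real \<Rightarrow> real) \<Rightarrow> (real \<Rightarrow> real) \<Rightarrow> (real \<Rightarrow> real \<Rightarrow> complex) \<Rightarrow> bool" where
  "closed_contour J \<theta> L z \<longleftrightarrow>
     (\<forall>t\<in>J. periodic_2pi (z t) \<and>
        (\<forall>\<alpha>. (z t has_vector_derivative
                complex_of_real (L t / (2 * pi)) * unit_tangent (\<theta> t) \<alpha>) (at \<alpha>)))"

definition contour_equation ::
  "real set \<Rightarrow> (real \<Rightarrow> real) \<Rightarrow> (real \<Rightarrow> real \<Rightarrow> real) \<Rightarrow> (real \<Rightarrow> real) \<Rightarrow>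
   (real \<Rightarrow> real \<Rightarrow> real) \<Rightarrow> (real \<Rightarrow> real \<Rightarrow> complex) \<Rightarrow> bool" where
  "contour_equation J T0 \<theta> L \<omega> z \<longleftrightarrow>
     (\<forall>t\<in>J. \<forall>\<alpha>. ((\<lambda>s. z s \<alpha>) has_vector_derivative
        (complex_of_real (normal_velocity (L t) (\<theta> t) (\<omega> t) \<alpha>) * unit_normal (\<theta> t) \<alpha>
         + complex_of_real (tangential_velocity (L t) (\<theta> t) (\<omega> t) (T0 t) \<alpha>)
           * unit_tangent (\<theta> t) \<alpha>))
       (at t within J))"

end

theory Submission
  imports Defs
begin

text \<open>
  For constant \<open>\<theta>\<close> the chord between two points of the curve can be computed explicitly, and up to
  the rotation by \<open>cis (- (\<alpha> + \<theta>0))\<close> the kernel of the Birkhoff--Rott integral becomes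
  \<open>cot (\<beta> / 2) / 2 + \<i> / 2\<close> (lemma \<open>BR_integrand_circle\<close>). Its imaginary part is constant, so
  the tangential term in the vorticity equation is a multiple of the mean of \<open>\<omega>\<close>; its real part
  is the periodic Hilbert kernel, which alone determines the normal velocity.

  Consequently every vorticity strength on a circle is of the form
  \<open>\<omega> \<alpha> = C - 2 * A\<^sub>\<rho> * R * sin (\<alpha> + \<theta>0)\<close> (lemma \<open>vorticity_circle_sinusoidal\<close>). The Hilbert
  transform kills constants and turns the sine into a negative cosine, so that, whatever \<open>C\<close> is,
  \<open>U \<alpha> = A\<^sub>\<rho> * cos (\<alpha> + \<theta>0)\<close>. Integration, with the prescribed value of \<open>T\<close> at \<open>0\<close>, gives
  \<open>T \<alpha> = A\<^sub>\<rho> * sin (\<alpha> + \<theta>0)\<close>. The right-hand sides of the evolution equations vanish because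
  \<open>\<partial>\<^sub>\<alpha> U + T = 0\<close> and \<open>U\<close> has mean zero. The choice \<open>C = 0\<close> gives a vorticity strength for
  every \<open>A\<^sub>\<mu>\<close>.

  Finally \<open>U n + T \<tau> = \<i> A\<^sub>\<rho> (cos x - \<i> sin x) cis x = \<i> A\<^sub>\<rho>\<close> with \<open>x = \<alpha> + \<theta>0\<close>, so the
  contour equation says that each point moves with velocity \<open>\<i> A\<^sub>\<rho>\<close>, while the prescribed
  tangent says that the curve is a circle of radius \<open>R\<close> at each time
  (lemma \<open>translating_circle_iff\<close>).
\<close>

section \<open>Principal values\<close>

lemma has_pv_integral_unique:
  assumes "has_pv_integral f I" "has_pv_integral f J"
  shows "I = J"
  using assms tendsto_unique[OF trivial_limit_at_right_real] unfolding has_pv_integral_def by blast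

lemma pv_integral_eqI: "has_pv_integral f I \<Longrightarrow> pv_integral f = I"
  unfolding pv_integral_def using has_pv_integral_unique by blast

lemma eventually_cutoff: "\<forall>\<^sub>F \<epsilon> in at_right 0. 0 < \<epsilon> \<and> \<epsilon> < (pi::real)"
  using pi_gt_zero unfolding eventually_at_right_field by blast

text \<open>
  The integrals over the two halves are continuous in the end point next to the singularity.
\<close>

lemma tendsto_integral_punctured:
  fixes g :: "real \<Rightarrow> 'a::banach"
  assumes g: "g integrable_on {-pi..pi}"
  shows "((\<lambda>\<epsilon>. integral ({-pi..-\<epsilon>} \<union> {\<epsilon>..pi}) g) \<longlongrightarrow> integral {-pi..pi} g) (at_right 0)"
proof -
  have l: "g integrable_on {-pi..0}" and r: "g integrable_on {0..pi}"
    using g by (auto intro: integrable_subinterval_real)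
  have "((\<lambda>x. integral {x..pi} g) \<longlongrightarrow> integral {0..pi} g) (at_right 0)"
    using continuous_on_Icc_at_rightD[OF indefinite_integral_continuous_1'[OF r]] by simp
  moreover have "((\<lambda>x. integral {-pi..-x} g) \<longlongrightarrow> integral {-pi..0} g) (at_right 0)"
    using continuous_on_Icc_at_leftD[OF indefinite_integral_continuous_1[OF l]]
    by (simp add: filterlim_at_left_to_right)
  ultimately have "((\<lambda>x. integral {-pi..-x} g + integral {x..pi} g) \<longlongrightarrow>
      integral {-pi..0} g + integral {0..pi} g) (at_right 0)"
    by (intro tendsto_add)
  moreover have "integral {-pi..0} g + integral {0..pi} g = integral {-pi..pi} g"
    using g by (intro Henstock_Kurzweil_Integration.integral_combine) auto
  moreover have "\<forall>\<^sub>F \<epsilon> in at_right 0. integral {-pi..-\<epsilon>} g + integral {\<epsilon>..pi} g =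
      integral ({-pi..-\<epsilon>} \<union> {\<epsilon>..pi}) g"
    using eventually_cutoff
  proof eventually_elim
    case (elim \<epsilon>)
    then have "{-pi..-\<epsilon>} \<inter> {\<epsilon>..pi} = {}" by auto
    moreover have "g integrable_on {-pi..-\<epsilon>}" "g integrable_on {\<epsilon>..pi}"
      using g elim by (auto intro: integrable_subinterval_real)
    ultimately show ?case by simp
  qed
  ultimately show ?thesis by (simp add: tendsto_cong)
qed

text \<open>
  A real linear functional may remove the singularity of a principal value integrand; its value on
  the principal value is then an ordinary integral. With the functional \<open>z \<mapsto> Im (c * z)\<close> this
  extracts the mean of an unknown vorticity without computing its Hilbert transform.
\<close>

lemma pv_integral_linear_image:
  fixes h :: "complex \<Rightarrow> real"
  assumes f: "has_pv_integral f I" and h: "bounded_linear h"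
    and hf: "\<And>\<beta>. \<beta> \<in> {-pi..pi} \<Longrightarrow> \<beta> \<noteq> 0 \<Longrightarrow> h (f \<beta>) = g \<beta>"
    and g: "g integrable_on {-pi..pi}"
  shows "h I = integral {-pi..pi} g"
proof (rule tendsto_unique[OF trivial_limit_at_right_real])
  let ?S = "\<lambda>\<epsilon>. {-pi..-\<epsilon>} \<union> {\<epsilon>..pi}"
  have "((\<lambda>\<epsilon>. h (set_lebesgue_integral lborel (?S \<epsilon>) f)) \<longlongrightarrow> h I) (at_right 0)"
    using f h unfolding has_pv_integral_def by (intro bounded_linear.tendsto[OF h]) simp
  moreover have "\<forall>\<^sub>F \<epsilon> in at_right 0. h (set_lebesgue_integral lborel (?S \<epsilon>) f) = integral (?S \<epsilon>) g"
    using eventually_cutoff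
  proof eventually_elim
    case (elim \<epsilon>)
    then have i: "set_integrable lborel (?S \<epsilon>) f"
      using f unfolding has_pv_integral_def by blast
    have "h (integral (?S \<epsilon>) f) = integral (?S \<epsilon>) (h \<circ> f)"
      using set_borel_integral_eq_integral(1)[OF i] h by (rule integral_linear[symmetric])
    also have "\<dots> = integral (?S \<epsilon>) g"
      using elim by (intro Henstock_Kurzweil_Integration.integral_cong) (auto simp: hf)
    finally show ?case
      using set_borel_integral_eq_integral(2)[OF i] by simp
  qed
  ultimately show "((\<lambda>\<epsilon>. integral (?S \<epsilon>) g) \<longlongrightarrow> h I) (at_right 0)"
    by (simp add: tendsto_cong)
qed (rule tendsto_integral_punctured[OF g])

text \<open>
  The existence of a principal value is the only source of integrability for an unknown density:
  it gives integrability away from the singularity, and only for the combination with the kernel.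
\<close>

lemma pv_linear_image_integrable_on:
  fixes h :: "complex \<Rightarrow> real"
  assumes f: "has_pv_integral f I" and h: "bounded_linear h"
    and hf: "\<And>\<beta>. \<beta> \<in> {-pi..pi} \<Longrightarrow> \<beta> \<noteq> 0 \<Longrightarrow> h (f \<beta>) = g \<beta>"
    and ab: "{a..b} \<subseteq> {-pi..pi} - {0}"
  shows "g integrable_on {a..b}"
proof (cases "a \<le> b")
  case True
  \<comment> \<open>Halving an end point keeps the cut-off below \<open>pi\<close>.\<close>
  then obtain \<epsilon> where \<epsilon>: "0 < \<epsilon>" "\<epsilon> < pi" and sub: "{a..b} \<subseteq> {-pi..-\<epsilon>} \<union> {\<epsilon>..pi}"
  proof (cases "0 < a")
    case True
    with \<open>a \<le> b\<close> ab have "b \<le> pi" by auto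
    with True \<open>a \<le> b\<close> show ?thesis by (intro that[of "a / 2"]) auto
  next
    case False
    with \<open>a \<le> b\<close> ab have "b < 0" "- pi \<le> a" by (auto simp: subset_iff not_less)
    with \<open>a \<le> b\<close> show ?thesis by (intro that[of "- b / 2"]) auto
  qed
  have "set_integrable lborel ({-pi..-\<epsilon>} \<union> {\<epsilon>..pi}) f"
    using f \<epsilon> unfolding has_pv_integral_def by simp
  then have "set_integrable lborel {a..b} f"
    by (rule set_integrable_subset) (use sub in auto)
  then have "(h \<circ> f) integrable_on {a..b}"
    by (intro integrable_linear h set_borel_integral_eq_integral)
  then show ?thesis
    by (rule integrable_eq) (use subsetD[OF ab] hf in simp)
qed auto

text \<open>
  The cut-off set is symmetric about \<open>0\<close>, so odd parts of the integrand cancel before the limit is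
  taken: only the even part, folded onto \<open>{0..pi}\<close>, has to be integrable.
\<close>

lemma has_pv_integral_symmetrized:
  fixes f :: "real \<Rightarrow> complex"
  assumes f: "continuous_on ({-pi..pi} - {0}) f"
    and g: "g integrable_on {0..pi}"
    and fg: "\<And>\<beta>. \<beta> \<in> {0<..pi} \<Longrightarrow> f (- \<beta>) + f \<beta> = g \<beta>"
  shows "has_pv_integral f (integral {0..pi} g)"
proof -
  let ?S = "\<lambda>\<epsilon>. {-pi..-\<epsilon>} \<union> {\<epsilon>..pi}"
  have cont: "continuous_on {-pi..-\<epsilon>} f" "continuous_on {\<epsilon>..pi} f" if "0 < \<epsilon>" for \<epsilon>
    using that by (auto intro: continuous_on_subset[OF f])
  have int: "set_integrable lborel {-pi..-\<epsilon>} f" "set_integrable lborel {\<epsilon>..pi} f" if "0 < \<epsilon>" for \<epsilon>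
    using cont[OF that] by (auto intro: borel_integrable_atLeastAtMost')
  have "((\<lambda>x. integral {x..pi} g) \<longlongrightarrow> integral {0..pi} g) (at_right 0)"
    using continuous_on_Icc_at_rightD[OF indefinite_integral_continuous_1'[OF g]] by simp
  moreover have "\<forall>\<^sub>F \<epsilon> in at_right 0. integral {\<epsilon>..pi} g = set_lebesgue_integral lborel (?S \<epsilon>) f"
    using eventually_cutoff
  proof eventually_elim
    case (elim \<epsilon>)
    then have "{-pi..-\<epsilon>} \<inter> {\<epsilon>..pi} = {}" by auto
    then have "set_lebesgue_integral lborel (?S \<epsilon>) f = integral {-pi..-\<epsilon>} f + integral {\<epsilon>..pi} f"
      using int[of \<epsilon>] elim by (simp add: set_integral_Un set_borel_integral_eq_integral(2))
    also have "integral {-pi..-\<epsilon>} f = integral {\<epsilon>..pi} (\<lambda>\<beta>. f (- \<beta>))"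
      using Henstock_Kurzweil_Integration.integral_reflect_real[of pi \<epsilon> "\<lambda>\<beta>. f (- \<beta>)"] by simp
    also have "\<dots> + integral {\<epsilon>..pi} f = integral {\<epsilon>..pi} (\<lambda>\<beta>. f (- \<beta>) + f \<beta>)"
    proof (rule Henstock_Kurzweil_Integration.integral_add[symmetric])
      show "f integrable_on {\<epsilon>..pi}"
        using cont elim by (intro integrable_continuous_real) auto
      have "f integrable_on {-pi..-\<epsilon>}"
        using cont elim by (intro integrable_continuous_real) auto
      then show "(\<lambda>\<beta>. f (- \<beta>)) integrable_on {\<epsilon>..pi}"
        using Henstock_Kurzweil_Integration.integrable_reflect_real[of f "-\<epsilon>" "-pi"] by simp
    qed
    also have "\<dots> = integral {\<epsilon>..pi} g"
      using elim by (intro Henstock_Kurzweil_Integration.integral_cong fg) auto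
    finally show ?case by simp
  qed
  ultimately show ?thesis
    unfolding has_pv_integral_def using int by (auto simp: tendsto_cong intro!: set_integrable_Un)
qed

section \<open>The Birkhoff--Rott kernel of a circle\<close>

lemma has_vector_derivative_cis_affine:
  "((\<lambda>s. cis (a + b * s)) has_vector_derivative complex_of_real b * (\<i> * cis (a + b * s))) (at s within S)"
  unfolding has_vector_derivative_def
  by (rule derivative_eq_intros refl | simp add: scaleR_conv_of_real mult_ac)+

text \<open>
  The mean of \<open>cis\<close> over the arc between the parameters \<open>\<alpha> - \<beta>\<close> and \<open>\<alpha>\<close> points in the direction of the midpoint of
  the arc, with modulus the ratio of the chord to the arc length.
\<close>

lemma chord_circle:
  assumes "\<beta> \<noteq> 0"
  shows "chord (\<lambda>_. \<theta>0) \<alpha> \<beta> = complex_of_real (sin (\<beta> / 2) / (\<beta> / 2)) * cis (\<alpha> + \<theta>0 - \<beta> / 2)"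
proof -
  let ?F = "\<lambda>s. cis (\<alpha> + \<theta>0 - \<beta> + \<beta> * s) / (\<i> * complex_of_real \<beta>)"
  have "(?F has_vector_derivative cis (\<alpha> + \<theta>0 - \<beta> + \<beta> * s)) (at s within S)" for s S
    using has_vector_derivative_divide[OF has_vector_derivative_cis_affine
        [of "\<alpha> + \<theta>0 - \<beta>" \<beta> s S], of "\<i> * complex_of_real \<beta>"] assms
    by simp
  then have "(LBINT s=0..1. cis (\<alpha> + \<theta>0 - \<beta> + \<beta> * s)) = ?F 1 - ?F 0"
    unfolding zero_ereal_def one_ereal_def
    by (intro interval_integral_FTC_finite continuous_intros)
  moreover have "chord (\<lambda>_. \<theta>0) \<alpha> \<beta> = (LBINT s=0..1. cis (\<alpha> + \<theta>0 - \<beta> + \<beta> * s))"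
    unfolding chord_def cis_mult by (simp add: algebra_simps)
  moreover have "?F 1 - ?F 0 = complex_of_real (sin (\<beta> / 2) / (\<beta> / 2)) * cis (\<alpha> + \<theta>0 - \<beta> / 2)"
  proof -
    have "cis (x + y) - cis (x - y) = 2 * \<i> * complex_of_real (sin y) * cis x" for x y :: real
      by (simp add: complex_eq_iff cos_add sin_add cos_diff sin_diff)
    from this[of "\<alpha> + \<theta>0 - \<beta> / 2" "\<beta> / 2"]
    have "cis (\<alpha> + \<theta>0) - cis (\<alpha> + \<theta>0 - \<beta>) =
        2 * \<i> * complex_of_real (sin (\<beta> / 2)) * cis (\<alpha> + \<theta>0 - \<beta> / 2)"
      by simp
    then show ?thesis
      using assms by (simp add: diff_divide_distrib [symmetric])
  qed
  ultimately show ?thesis by simp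
qed

text \<open>
  The kernel of the circle has \<open>sin (\<beta> / 2)\<close> as its denominator, so this is the absence of
  singularities other than \<open>\<beta> = 0\<close>.
\<close>

lemma sin_half_nonzero:
  assumes "\<beta> \<in> {-pi..pi}" "\<beta> \<noteq> 0"
  shows "sin (\<beta> / 2) \<noteq> 0"
proof -
  have "0 < sin (\<bar>\<beta>\<bar> / 2)"
    using assms by (intro sin_gt_zero) auto
  then show ?thesis
    by (auto simp: abs_if split: if_splits)
qed

text \<open>
  The key feature of the circle: apart from the unimodular factor \<open>cis (- (\<alpha> + \<theta>0))\<close>, the kernel has
  the periodic Hilbert kernel as its real part and a constant as its imaginary part. The
  tangential component of the velocity therefore sees only the mean of \<open>\<omega>\<close>, and the normal
  component only its Hilbert transform.
\<close>

lemma BR_integrand_circle: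
  assumes "\<beta> \<in> {-pi..pi}" "\<beta> \<noteq> 0"
  shows "BR_integrand (\<lambda>_. \<theta>0) \<omega> \<alpha> \<beta> =
    complex_of_real (\<omega> (\<alpha> - \<beta>)) * (cis (- (\<alpha> + \<theta>0)) * Complex (cot (\<beta> / 2) / 2) (1 / 2))"
proof -
  have s: "sin (\<beta> / 2) \<noteq> 0"
    using sin_half_nonzero assms by blast
  have "BR_integrand (\<lambda>_. \<theta>0) \<omega> \<alpha> \<beta> =
      complex_of_real (\<omega> (\<alpha> - \<beta>)) * (inverse (cis (\<alpha> + \<theta>0 - \<beta> / 2)) / (2 * complex_of_real (sin (\<beta> / 2))))"
    using assms s unfolding BR_integrand_def by (simp add: chord_circle field_simps del: cis_inverse)
  also have "inverse (cis (\<alpha> + \<theta>0 - \<beta> / 2)) = cis (- (\<alpha> + \<theta>0)) * cis (\<beta> / 2)"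
    by (simp add: cis_mult algebra_simps)
  also have "\<dots> / (2 * complex_of_real (sin (\<beta> / 2))) =
      cis (- (\<alpha> + \<theta>0)) * (cis (\<beta> / 2) / (2 * complex_of_real (sin (\<beta> / 2))))"
    by simp
  also have "cis (\<beta> / 2) / (2 * complex_of_real (sin (\<beta> / 2))) = Complex (cot (\<beta> / 2) / 2) (1 / 2)"
  proof -
    have "cis (\<beta> / 2) = Complex (cot (\<beta> / 2) / 2) (1 / 2) * (2 * complex_of_real (sin (\<beta> / 2)))"
      using s by (simp add: complex_eq_iff cot_def)
    then show ?thesis using s by simp
  qed
  finally show ?thesis .
qed

section \<open>Every vorticity strength on a circle is a shifted sinusoid\<close>

text \<open>
  Both integrals extend to the integral over \<open>{a..b + 2 * pi}\<close>, and the two added pieces are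
  translates of each other by one period.
\<close>

lemma periodic_integral_shift:
  fixes f :: "real \<Rightarrow> real"
  assumes per: "periodic_2pi f" and int: "\<And>a b. f integrable_on {a..b}"
  shows "integral {a..a + 2 * pi} f = integral {b..b + 2 * pi} f"
proof (induction a b rule: linorder_wlog)
  case (le a b)
  have "integral {a + 2 * pi..b + 2 * pi} f = integral {a..b} f"
    using integral_shift_real_ivl[of "a + 2 * pi" "2 * pi" "b + 2 * pi" f] per
    by (simp add: periodic_2pi_def)
  moreover have "integral {a..a + 2 * pi} f + integral {a + 2 * pi..b + 2 * pi} f =
      integral {a..b + 2 * pi} f"
    using le int by (intro Henstock_Kurzweil_Integration.integral_combine) auto
  moreover have "integral {a..b} f + integral {b..b + 2 * pi} f = integral {a..b + 2 * pi} f"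
    using le int by (intro Henstock_Kurzweil_Integration.integral_combine) auto
  ultimately show ?case by simp
qed simp

lemma bounded_linear_Im_mult: "bounded_linear (\<lambda>z. Im (c * z))"
  by (intro bounded_linear_compose[OF bounded_linear_Im] bounded_linear_mult_right)

lemma Im_BR_integrand_circle:
  assumes "\<beta> \<in> {-pi..pi}" "\<beta> \<noteq> 0"
  shows "Im (cis (\<alpha> + \<theta>0) * BR_integrand (\<lambda>_. \<theta>0) \<omega> \<alpha> \<beta>) = \<omega> (\<alpha> - \<beta>) / 2"
proof -
  have "cis (\<alpha> + \<theta>0) * BR_integrand (\<lambda>_. \<theta>0) \<omega> \<alpha> \<beta> =
      (cis (\<alpha> + \<theta>0) * cis (- (\<alpha> + \<theta>0))) * (complex_of_real (\<omega> (\<alpha> - \<beta>)) * Complex (cot (\<beta> / 2) / 2) (1 / 2))"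
    by (simp add: BR_integrand_circle[OF assms])
  also have "cis (\<alpha> + \<theta>0) * cis (- (\<alpha> + \<theta>0)) = 1"
    unfolding cis_mult by simp
  finally show ?thesis by simp
qed

text \<open>
  The principal value at \<open>c + 2\<close> controls \<open>\<omega>\<close> on \<open>{c..c + 1}\<close>, which corresponds to
  \<open>\<beta> \<in> {1..2}\<close> and so avoids the singularity. Since the base point is free, such
  unit intervals cover every bounded interval.
\<close>

lemma vorticity_locally_integrable:
  assumes pv: "\<And>\<alpha>. \<exists>I. has_pv_integral (BR_integrand (\<lambda>_. \<theta>0) \<omega> \<alpha>) I"
  shows "\<omega> integrable_on {a..b}"
proof -
  have unit: "\<omega> integrable_on {c..c + 1}" for c
  proof -
    obtain I where I: "has_pv_integral (BR_integrand (\<lambda>_. \<theta>0) \<omega> (c + 2)) I"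
      using pv by blast
    have "(\<lambda>\<beta>. \<omega> (c + 2 - \<beta>) / 2) integrable_on {1..2}"
      by (rule pv_linear_image_integrable_on[OF I bounded_linear_Im_mult Im_BR_integrand_circle])
        (use pi_gt3 in auto)
    then have "(\<lambda>\<beta>. \<omega> (c + 2 - \<beta>) / 2 * 2) integrable_on {1..2}"
      by (intro integrable_on_mult_left)
    then have "(\<lambda>x. \<omega> (x + (c + 2))) integrable_on {-2..-1}"
      using Henstock_Kurzweil_Integration.integrable_reflect_real[of "\<lambda>x. \<omega> (x + (c + 2))" "-1" "-2"]
      by (simp add: algebra_simps)
    then show ?thesis
      using integrable_shift_real_ivl_iff[of \<omega> "c + 2" c "c + 1"] by (simp add: algebra_simps)
  qed
  have "\<omega> integrable_on {a..a + real n}" for n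
  proof (induction n)
    case (Suc n)
    have "\<omega> integrable_on {a..a + real n + 1}"
      using Henstock_Kurzweil_Integration.integrable_combine[OF _ _ Suc unit[of "a + real n"]] by simp
    then show ?case
      by (simp add: add.assoc add.commute[of 1])
  qed (use integrable_on_refl[of \<omega> a] in simp)
  moreover obtain n where "b - a \<le> real n"
    using real_arch_simple by blast
  ultimately show ?thesis
    by (metis add.commute atLeastatMost_subset_iff diff_le_eq integrable_subinterval_real order_refl)
qed

text \<open>
  The value does not depend on \<open>\<alpha>\<close>, because the imaginary part of the rotated kernel is constant and
  the integral of a periodic function over a period does not depend on where the period starts.
\<close>

lemma Re_BR_conj_tangent_circle:
  assumes per: "periodic_2pi \<omega>"
    and pv: "\<And>\<alpha>. \<exists>I. has_pv_integral (BR_integrand (\<lambda>_. \<theta>0) \<omega> \<alpha>) I"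
  shows "Re (BR_conj L (\<lambda>_. \<theta>0) \<omega> \<alpha> * cis (\<alpha> + \<theta>0)) = integral {-pi..pi} \<omega> / (2 * L)"
proof -
  note int = vorticity_locally_integrable[OF pv]
  obtain I where I: "has_pv_integral (BR_integrand (\<lambda>_. \<theta>0) \<omega> \<alpha>) I"
    using pv by blast
  have refl: "(\<lambda>\<beta>. \<omega> (\<alpha> - \<beta>)) integrable_on {-pi..pi}"
    "integral {-pi..pi} (\<lambda>\<beta>. \<omega> (\<alpha> - \<beta>)) = integral {\<alpha> - pi..\<alpha> + pi} \<omega>"
    using Henstock_Kurzweil_Integration.integrable_reflect_real[of "\<lambda>x. \<omega> (x + \<alpha>)" pi "-pi"]
      Henstock_Kurzweil_Integration.integral_reflect_real[of pi "-pi" "\<lambda>x. \<omega> (x + \<alpha>)"]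
      integrable_shift_real_ivl_iff[of \<omega> \<alpha> "\<alpha> - pi" "\<alpha> + pi"]
      integral_shift_real_ivl[of "\<alpha> - pi" \<alpha> "\<alpha> + pi" \<omega>] int
    by (simp_all add: algebra_simps)
  have "Im (cis (\<alpha> + \<theta>0) * I) = integral {-pi..pi} (\<lambda>\<beta>. \<omega> (\<alpha> - \<beta>) / 2)"
    using refl(1)
    by (intro pv_integral_linear_image[OF I bounded_linear_Im_mult Im_BR_integrand_circle]) auto
  also have "\<dots> = integral {\<alpha> - pi..\<alpha> + pi} \<omega> / 2"
    using refl(2) by simp
  also have "integral {\<alpha> - pi..\<alpha> + pi} \<omega> = integral {-pi..pi} \<omega>"
    using periodic_integral_shift[OF per int, of "\<alpha> - pi" "-pi"] by (simp add: algebra_simps)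
  finally have "Im (cis (\<alpha> + \<theta>0) * I) = integral {-pi..pi} \<omega> / 2" .
  moreover have "BR_conj L (\<lambda>_. \<theta>0) \<omega> \<alpha> * cis (\<alpha> + \<theta>0) = (cis (\<alpha> + \<theta>0) * I) / (\<i> * complex_of_real L)"
    unfolding BR_conj_def pv_integral_eqI[OF I] by simp
  moreover have "Re (z / (\<i> * complex_of_real L)) = Im z / L" for z
    by (simp add: Re_divide power2_eq_square)
  ultimately have "Re (BR_conj L (\<lambda>_. \<theta>0) \<omega> \<alpha> * cis (\<alpha> + \<theta>0)) = integral {-pi..pi} \<omega> / 2 / L"
    by (simp only:)
  then show ?thesis by simp
qed

text \<open>
  Since the term with \<open>A\<^sub>\<mu>\<close> is constant and the curvature term vanishes, the vorticity equation
  leaves only the gravity term and an additive constant. This fixes the shape of \<open>\<omega>\<close> also for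
  \<open>A\<^sub>\<mu> = -1\<close>, where the equation does not determine the mean of \<open>\<omega>\<close>.
\<close>

lemma vorticity_circle_sinusoidal:
  assumes "is_vorticity A\<^sub>\<mu> A\<^sub>\<sigma> A\<^sub>\<rho> (2 * pi * R) (\<lambda>_. \<theta>0) \<omega>"
  obtains C where "\<omega> = (\<lambda>\<alpha>. C - 2 * A\<^sub>\<rho> * R * sin (\<alpha> + \<theta>0))"
proof
  show "\<omega> = (\<lambda>\<alpha>. - 2 * A\<^sub>\<mu> * R * (integral {-pi..pi} \<omega> / (2 * (2 * pi * R))) - 2 * A\<^sub>\<rho> * R * sin (\<alpha> + \<theta>0))"
  proof
    fix \<alpha>
    have eq: "\<omega> \<alpha> = - 2 * A\<^sub>\<mu> * (2 * pi * R / (2 * pi)) * Re (BR_conj (2 * pi * R) (\<lambda>_. \<theta>0) \<omega> \<alpha> * cis (\<alpha> + \<theta>0))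
        + 2 * A\<^sub>\<sigma> * (2 * pi / (2 * pi * R)) * deriv (deriv (\<lambda>_. \<theta>0)) \<alpha>
        - 2 * A\<^sub>\<rho> * (2 * pi * R / (2 * pi)) * sin (\<alpha> + \<theta>0)"
      using assms unfolding is_vorticity_def by blast
    have "Re (BR_conj (2 * pi * R) (\<lambda>_. \<theta>0) \<omega> \<alpha> * cis (\<alpha> + \<theta>0)) = integral {-pi..pi} \<omega> / (2 * (2 * pi * R))"
      using assms unfolding is_vorticity_def by (intro Re_BR_conj_tangent_circle) blast+
    with eq show "\<omega> \<alpha> = - 2 * A\<^sub>\<mu> * R * (integral {-pi..pi} \<omega> / (2 * (2 * pi * R))) - 2 * A\<^sub>\<rho> * R * sin (\<alpha> + \<theta>0)"
      by simp
  qed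
qed

section \<open>Velocities of a circle\<close>

text \<open>
  The only nontrivial singular integral here is \<open>\<integral> cot (\<beta> / 2) * sin \<beta>\<close>, and its integrand is the regular function \<open>1 + cos \<beta>\<close>.
\<close>

lemma has_pv_integral_circle_sinusoidal:
  "has_pv_integral (BR_integrand (\<lambda>_. \<theta>0) (\<lambda>\<eta>. C + K * sin (\<eta> + \<theta>0)) \<alpha>)
     (complex_of_real pi * (cis (- (\<alpha> + \<theta>0)) * Complex (- K * cos (\<alpha> + \<theta>0)) C))"
proof -
  define x where "x = \<alpha> + \<theta>0"
  let ?f = "BR_integrand (\<lambda>_. \<theta>0) (\<lambda>\<eta>. C + K * sin (\<eta> + \<theta>0)) \<alpha>"
  let ?h = "\<lambda>\<beta>. complex_of_real (C + K * sin (x - \<beta>)) * (cis (- x) * Complex (cot (\<beta> / 2) / 2) (1 / 2))"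
  let ?g = "\<lambda>\<beta>. cis (- x) * Complex (- K * cos x * (1 + cos \<beta>)) (C + K * sin x * cos \<beta>)"
  have f: "?f \<beta> = ?h \<beta>" if "\<beta> \<in> {-pi..pi}" "\<beta> \<noteq> 0" for \<beta>
    unfolding BR_integrand_circle[OF that] x_def by (simp add: diff_add_eq)
  have "continuous_on ({-pi..pi} - {0}) ?h"
    unfolding cot_def Complex_eq using sin_half_nonzero by (intro continuous_intros) auto
  then have cont: "continuous_on ({-pi..pi} - {0}) ?f"
    by (rule continuous_on_eq) (use f in auto)
  \<comment> \<open>The part of the density even in \<open>\<beta>\<close> contributes nothing through the odd kernel \<open>cot (\<beta> / 2)\<close>.\<close>
  have "?f (- \<beta>) + ?f \<beta> = ?g \<beta>" if "\<beta> \<in> {0<..pi}" for \<beta>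
  proof -
    have "sin (\<beta> / 2) \<noteq> 0"
      using that sin_half_nonzero[of \<beta>] by auto
    then have cot: "cot (\<beta> / 2) * sin \<beta> = 1 + cos \<beta>"
      using sin_double[of "\<beta> / 2"] cos_double_cos[of "\<beta> / 2"]
      by (simp add: cot_def power2_eq_square)
    have "?f (- \<beta>) + ?f \<beta> = ?h (- \<beta>) + ?h \<beta>"
      using that by (simp add: f)
    also have "\<dots> = cis (- x) * (complex_of_real (C + K * sin (x + \<beta>)) * Complex (- cot (\<beta> / 2) / 2) (1 / 2) +
        complex_of_real (C + K * sin (x - \<beta>)) * Complex (cot (\<beta> / 2) / 2) (1 / 2))"
      by (simp add: algebra_simps cot_def)
    also have "complex_of_real (C + K * sin (x + \<beta>)) * Complex (- cot (\<beta> / 2) / 2) (1 / 2) +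
        complex_of_real (C + K * sin (x - \<beta>)) * Complex (cot (\<beta> / 2) / 2) (1 / 2) =
        Complex (- K * cos x * (cot (\<beta> / 2) * sin \<beta>)) (C + K * sin x * cos \<beta>)"
      by (simp add: complex_eq_iff sin_add sin_diff field_simps)
    finally show ?thesis unfolding cot .
  qed
  moreover
  let ?G = "\<lambda>\<beta>. cis (- x) * Complex (- K * cos x * (\<beta> + sin \<beta>)) (C * \<beta> + K * sin x * sin \<beta>)"
  have "(?g has_integral ?G pi - ?G 0) {0..pi}"
  proof (rule fundamental_theorem_of_calculus)
    fix \<beta> :: real
    have "((\<lambda>\<beta>. Complex (- K * cos x * (\<beta> + sin \<beta>)) (C * \<beta> + K * sin x * sin \<beta>)) has_vector_derivative
        Complex (- K * cos x * (1 + cos \<beta>)) (C + K * sin x * cos \<beta>)) (at \<beta> within {0..pi})"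
      unfolding has_vector_derivative_complex_iff by (auto intro!: derivative_eq_intros)
    then show "(?G has_vector_derivative ?g \<beta>) (at \<beta> within {0..pi})"
      by (rule has_vector_derivative_mult_right)
  qed simp
  moreover have "?G pi - ?G 0 = complex_of_real pi * (cis (- x) * Complex (- K * cos x) C)"
    by (simp add: complex_eq_iff algebra_simps)
  ultimately show ?thesis
    using has_pv_integral_symmetrized[OF cont, of ?g]
    by (metis (no_types, lifting) has_integral_integrable integral_unique x_def)
qed

lemma BR_conj_circle_sinusoidal:
  "BR_conj (2 * pi * R) (\<lambda>_. \<theta>0) (\<lambda>\<eta>. C + K * sin (\<eta> + \<theta>0)) \<alpha> =
     cis (- (\<alpha> + \<theta>0)) * (Complex C (K * cos (\<alpha> + \<theta>0)) / complex_of_real (2 * R))"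
proof -
  have "Complex (- K * cos (\<alpha> + \<theta>0)) C = \<i> * Complex C (K * cos (\<alpha> + \<theta>0))"
    by (simp add: complex_eq_iff)
  then show ?thesis
    unfolding BR_conj_def pv_integral_eqI[OF has_pv_integral_circle_sinusoidal] by simp
qed

text \<open>
  For a vorticity with mean zero, \<open>BR_conj\<close> is purely imaginary after rotation by the tangent, so the
  term with \<open>A\<^sub>\<mu>\<close> vanishes and the equation holds for every \<open>A\<^sub>\<mu>\<close>.
\<close>

lemma circle_sinusoidal_is_vorticity:
  "is_vorticity A\<^sub>\<mu> A\<^sub>\<sigma> A\<^sub>\<rho> (2 * pi * R) (\<lambda>_. \<theta>0) (\<lambda>\<alpha>. - 2 * A\<^sub>\<rho> * R * sin (\<alpha> + \<theta>0))"
proof -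
  let ?w = "\<lambda>\<alpha>. 0 + (- 2 * A\<^sub>\<rho> * R) * sin (\<alpha> + \<theta>0)"
  have "sin (\<alpha> + 2 * pi + \<theta>0) = sin (\<alpha> + \<theta>0)" for \<alpha>
    using sin_periodic[of "\<alpha> + \<theta>0"] by (simp only: ac_simps)
  then have periodic: "periodic_2pi ?w"
    unfolding periodic_2pi_def by simp
  have Re_0: "Re (BR_conj (2 * pi * R) (\<lambda>_. \<theta>0) ?w \<alpha> * cis (\<alpha> + \<theta>0)) = 0" for \<alpha>
  proof -
    have "BR_conj (2 * pi * R) (\<lambda>_. \<theta>0) ?w \<alpha> * cis (\<alpha> + \<theta>0) =
        (cis (- (\<alpha> + \<theta>0)) * cis (\<alpha> + \<theta>0)) * (Complex 0 (- 2 * A\<^sub>\<rho> * R * cos (\<alpha> + \<theta>0)) / complex_of_real (2 * R))"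
      unfolding BR_conj_circle_sinusoidal by (simp only: mult_ac)
    then show ?thesis
      unfolding cis_mult by (simp add: Re_divide)
  qed
  have pv: "\<exists>I. has_pv_integral (BR_integrand (\<lambda>_. \<theta>0) ?w \<alpha>) I" for \<alpha>
    using has_pv_integral_circle_sinusoidal by blast
  have "is_vorticity A\<^sub>\<mu> A\<^sub>\<sigma> A\<^sub>\<rho> (2 * pi * R) (\<lambda>_. \<theta>0) ?w"
    unfolding is_vorticity_def Re_0 using periodic pv by simp
  then show ?thesis by simp
qed

text \<open>
  The additive constant in \<open>\<omega>\<close> enters \<open>BR_conj\<close> only through its tangential component, and the
  Hilbert transform takes the sine to a negative cosine.
\<close>

lemma normal_velocity_circle:
  assumes "is_vorticity A\<^sub>\<mu> A\<^sub>\<sigma> A\<^sub>\<rho> (2 * pi * R) (\<lambda>_. \<theta>0) \<omega>" "R \<noteq> 0"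
  shows "normal_velocity (2 * pi * R) (\<lambda>_. \<theta>0) \<omega> = (\<lambda>\<alpha>. A\<^sub>\<rho> * cos (\<alpha> + \<theta>0))"
proof
  fix \<alpha>
  obtain C where "\<omega> = (\<lambda>\<alpha>. C - 2 * A\<^sub>\<rho> * R * sin (\<alpha> + \<theta>0))"
    using vorticity_circle_sinusoidal[OF assms(1)] .
  then have \<omega>: "\<omega> = (\<lambda>\<eta>. C + (- 2 * A\<^sub>\<rho> * R) * sin (\<eta> + \<theta>0))"
    by simp
  have "BR_conj (2 * pi * R) (\<lambda>_. \<theta>0) \<omega> \<alpha> * (\<i> * cis (\<alpha> + \<theta>0)) =
      (cis (- (\<alpha> + \<theta>0)) * cis (\<alpha> + \<theta>0)) * (\<i> * Complex C (- 2 * A\<^sub>\<rho> * R * cos (\<alpha> + \<theta>0)) / complex_of_real (2 * R))"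
    unfolding \<omega> BR_conj_circle_sinusoidal by (simp add: mult_ac)
  then show "normal_velocity (2 * pi * R) (\<lambda>_. \<theta>0) \<omega> \<alpha> = A\<^sub>\<rho> * cos (\<alpha> + \<theta>0)"
    unfolding normal_velocity_def cis_mult using assms(2) by (simp add: Re_divide power2_eq_square)
qed

lemma interval_integral_cos_shift: "(LBINT \<eta>=a..b. cos (\<eta> + c)) = sin (b + c) - sin (a + c)"
  for a b c :: real
  by (rule interval_integral_FTC_finite)
    (auto intro!: continuous_intros derivative_eq_intros
      simp flip: has_real_derivative_iff_has_vector_derivative)

lemma interval_integral_cos_period: "(LBINT \<eta>=-pi..pi. cos (\<eta> + c)) = 0" for c :: real
  using interval_integral_cos_shift[of "-pi" pi c] by (simp add: sin_add)

text \<open>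
  The prescribed value at \<open>\<alpha> = 0\<close> cancels the constant of integration, so \<open>T\<close> has mean
  zero: the points of the curve do not circulate around it.
\<close>

lemma tangential_velocity_circle:
  assumes "normal_velocity L (\<lambda>_. \<theta>0) \<omega> = (\<lambda>\<alpha>. A\<^sub>\<rho> * cos (\<alpha> + \<theta>0))"
  shows "tangential_velocity L (\<lambda>_. \<theta>0) \<omega> (A\<^sub>\<rho> * sin \<theta>0) \<alpha> = A\<^sub>\<rho> * sin (\<alpha> + \<theta>0)"
proof -
  have "(LBINT \<eta>=0..\<alpha>. cos (\<eta> + \<theta>0)) = sin (\<alpha> + \<theta>0) - sin \<theta>0"
    using interval_integral_cos_shift[of 0 \<alpha>] by (simp add: zero_ereal_def)
  then show ?thesis
    unfolding tangential_velocity_def assms using interval_integral_cos_period[of \<theta>0]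
    by (simp add: right_diff_distrib)
qed

lemma admissible_shape_circle:
  assumes "R > 0"
  shows "admissible_shape (2 * pi * R) (\<lambda>_. \<theta>0)"
proof -
  have "chord (\<lambda>_. \<theta>0) \<alpha> \<beta> \<noteq> 0" if "\<beta> \<in> {-pi..pi}" for \<alpha> \<beta>
  proof (cases "\<beta> = 0")
    case True
    then have "chord (\<lambda>_. \<theta>0) \<alpha> \<beta> = cis \<alpha> * cis \<theta>0"
      unfolding chord_def
      by (simp add: zero_ereal_def one_ereal_def interval_integral_Icc set_lebesgue_integral_def)
    then show ?thesis by simp
  next
    case False
    then show ?thesis
      using sin_half_nonzero[OF that] by (simp add: chord_circle)
  qed
  moreover have "(LBINT \<alpha>=-pi..pi. cis (\<alpha> + \<theta>0)) = 0"
  proof -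
    have "((\<lambda>\<alpha>. - \<i> * cis (\<alpha> + \<theta>0)) has_vector_derivative cis (\<alpha> + \<theta>0)) (at \<alpha> within S)" for \<alpha> S
      using has_vector_derivative_mult_right[OF has_vector_derivative_cis_affine[of \<theta>0 1 \<alpha> S], of "- \<i>"]
      by (simp add: add.commute)
    then have "(LBINT \<alpha>=-pi..pi. cis (\<alpha> + \<theta>0)) = - \<i> * cis (pi + \<theta>0) - (- \<i> * cis (- pi + \<theta>0))"
      by (intro interval_integral_FTC_finite[where F = "\<lambda>\<alpha>. - \<i> * cis (\<alpha> + \<theta>0)"] continuous_intros)
    also have "\<dots> = 0"
      by (simp add: complex_eq_iff sin_add cos_add)
    finally show ?thesis .
  qed
  ultimately show ?thesis
    using assms unfolding admissible_shape_def periodic_2pi_def by auto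
qed

text \<open>
  Constancy of \<open>\<theta>\<close> amounts to \<open>\<partial>\<^sub>\<alpha> U + T = 0\<close>, and constancy of \<open>L\<close> to the vanishing
  of the integral of a cosine over a period.
\<close>

lemma theta_L_solution_circle:
  assumes "R > 0" and vort: "\<And>t. t \<in> J \<Longrightarrow> is_vorticity A\<^sub>\<mu> A\<^sub>\<sigma> A\<^sub>\<rho> (2 * pi * R) (\<lambda>_. \<theta>0) (\<omega> t)"
  shows "theta_L_solution J A\<^sub>\<mu> A\<^sub>\<sigma> A\<^sub>\<rho> (\<lambda>t. A\<^sub>\<rho> * sin \<theta>0) (\<lambda>t \<alpha>. \<theta>0) (\<lambda>t. 2 * pi * R) \<omega>"
  unfolding theta_L_solution_def
proof (intro ballI conjI allI)
  fix t \<alpha> assume t: "t \<in> J"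
  have U: "normal_velocity (2 * pi * R) (\<lambda>_. \<theta>0) (\<omega> t) = (\<lambda>\<alpha>. A\<^sub>\<rho> * cos (\<alpha> + \<theta>0))"
    using vort[OF t] assms(1) by (intro normal_velocity_circle) auto
  note T = tangential_velocity_circle[OF U]
  have U': "((\<lambda>\<alpha>. A\<^sub>\<rho> * cos (\<alpha> + \<theta>0)) has_real_derivative - (A\<^sub>\<rho> * sin (\<alpha> + \<theta>0))) (at \<alpha>)"
    by (auto intro!: derivative_eq_intros)
  show "admissible_shape (2 * pi * R) (\<lambda>\<alpha>. \<theta>0)"
    by (rule admissible_shape_circle) fact
  show "is_vorticity A\<^sub>\<mu> A\<^sub>\<sigma> A\<^sub>\<rho> (2 * pi * R) (\<lambda>\<alpha>. \<theta>0) (\<omega> t)"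
    by (rule vort) fact
  show "normal_velocity (2 * pi * R) (\<lambda>\<alpha>. \<theta>0) (\<omega> t) field_differentiable at \<alpha>"
    unfolding U field_differentiable_def using U' by blast
  show "set_integrable lborel {-pi..pi}
      (\<lambda>\<eta>. (1 + deriv (\<lambda>\<alpha>. \<theta>0) \<eta>) * normal_velocity (2 * pi * R) (\<lambda>\<alpha>. \<theta>0) (\<omega> t) \<eta>)"
    unfolding U by (intro borel_integrable_atLeastAtMost') (auto intro!: continuous_intros)
  show "((\<lambda>s. \<theta>0) has_real_derivative
      (2 * pi / (2 * pi * R) * deriv (normal_velocity (2 * pi * R) (\<lambda>\<alpha>. \<theta>0) (\<omega> t)) \<alpha>
       + 2 * pi / (2 * pi * R) * tangential_velocity (2 * pi * R) (\<lambda>\<alpha>. \<theta>0) (\<omega> t) (A\<^sub>\<rho> * sin \<theta>0) \<alpha>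
         * (1 + deriv (\<lambda>\<alpha>. \<theta>0) \<alpha>))) (at t within J)"
    unfolding T unfolding U DERIV_imp_deriv[OF U'] by simp
  show "((\<lambda>t. 2 * pi * R) has_real_derivative
      - (LBINT \<alpha>=-pi..pi. (1 + deriv (\<lambda>\<alpha>. \<theta>0) \<alpha>) * normal_velocity (2 * pi * R) (\<lambda>\<alpha>. \<theta>0) (\<omega> t) \<alpha>))
      (at t within J)"
    unfolding U using interval_integral_cos_period[of \<theta>0] by simp
qed

lemma mean_value_const: "mean_value (\<lambda>_. c) = c"
  unfolding mean_value_def by (simp add: interval_integral_Icc set_lebesgue_integral_def)

section \<open>The moving contour\<close>

text \<open>
  Normal and tangential parts recombine to the rigid vertical velocity: the left-hand side is
  \<open>\<i> * A * cis (- x) * cis x\<close>.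
\<close>

lemma circle_velocity:
  "complex_of_real (A * cos x) * (\<i> * cis x) + complex_of_real (A * sin x) * cis x = \<i> * complex_of_real A"
proof -
  have "complex_of_real (A * cos x) * (\<i> * cis x) + complex_of_real (A * sin x) * cis x =
      \<i> * complex_of_real A * (cis (- x) * cis x)"
    by (simp add: complex_eq_iff algebra_simps)
  then show ?thesis
    unfolding cis_mult by simp
qed

lemma contour_equation_circle_iff:
  assumes "R \<noteq> 0" and vort: "\<And>t. t \<in> J \<Longrightarrow> is_vorticity A\<^sub>\<mu> A\<^sub>\<sigma> A\<^sub>\<rho> (2 * pi * R) (\<lambda>_. \<theta>0) (\<omega> t)"
  shows "contour_equation J (\<lambda>t. A\<^sub>\<rho> * sin \<theta>0) (\<lambda>t \<alpha>. \<theta>0) (\<lambda>t. 2 * pi * R) \<omega> z \<longleftrightarrow>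
    (\<forall>t\<in>J. \<forall>\<alpha>. ((\<lambda>s. z s \<alpha>) has_vector_derivative \<i> * complex_of_real A\<^sub>\<rho>) (at t within J))"
proof -
  have "complex_of_real (normal_velocity (2 * pi * R) (\<lambda>_. \<theta>0) (\<omega> t) \<alpha>) * unit_normal (\<lambda>_. \<theta>0) \<alpha>
         + complex_of_real (tangential_velocity (2 * pi * R) (\<lambda>_. \<theta>0) (\<omega> t) (A\<^sub>\<rho> * sin \<theta>0) \<alpha>)
           * unit_tangent (\<lambda>_. \<theta>0) \<alpha> = \<i> * complex_of_real A\<^sub>\<rho>" if "t \<in> J" for t \<alpha>
  proof -
    note U = normal_velocity_circle[OF vort[OF that] assms(1)]
    show ?thesis
      unfolding tangential_velocity_circle[OF U] unfolding U unit_normal_def unit_tangent_def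
      by (rule circle_velocity)
  qed
  then show ?thesis
    unfolding contour_equation_def by simp
qed

lemma circle_parametrization_derivative:
  "((\<lambda>\<alpha>. c - \<i> * complex_of_real R * cis (\<alpha> + \<theta>0)) has_vector_derivative
     complex_of_real R * cis (\<alpha> + \<theta>0)) (at \<alpha> within S)"
  using has_vector_derivative_diff[OF has_vector_derivative_const has_vector_derivative_mult_right
      [OF has_vector_derivative_cis_affine[of \<theta>0 1 \<alpha> S], of "\<i> * complex_of_real R"], of c]
  by (simp add: add.commute mult.assoc mult.left_commute[of "complex_of_real R" \<i>])

text \<open>
  A curve with the prescribed tangent is determined up to a translation; here the translation may
  depend on time.
\<close>

lemma closed_contour_circle_iff:
  "closed_contour J (\<lambda>t \<alpha>. \<theta>0) (\<lambda>t. 2 * pi * R) z \<longleftrightarrow>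
     (\<forall>t\<in>J. \<exists>c. \<forall>\<alpha>. z t \<alpha> = c - \<i> * complex_of_real R * cis (\<alpha> + \<theta>0))"
proof -
  have "(periodic_2pi y \<and> (\<forall>\<alpha>. (y has_vector_derivative complex_of_real R * cis (\<alpha> + \<theta>0)) (at \<alpha>))) \<longleftrightarrow>
      (\<exists>c. \<forall>\<alpha>. y \<alpha> = c - \<i> * complex_of_real R * cis (\<alpha> + \<theta>0))" (is "?L \<longleftrightarrow> ?R") for y
  proof
    assume ?L
    then have y: "(y has_vector_derivative complex_of_real R * cis (\<alpha> + \<theta>0)) (at \<alpha>)" for \<alpha>
      by blast
    have "((\<lambda>\<alpha>. y \<alpha> - (0 - \<i> * complex_of_real R * cis (\<alpha> + \<theta>0))) has_vector_derivative 0) (at \<alpha>)" for \<alpha>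
      using has_vector_derivative_diff[OF y circle_parametrization_derivative[of 0 R \<theta>0]]
      by (simp only: diff_self)
    from has_vector_derivative_zero_constant[OF convex_UNIV this]
    obtain c where c: "\<And>\<alpha>. \<alpha> \<in> UNIV \<Longrightarrow> y \<alpha> - (0 - \<i> * complex_of_real R * cis (\<alpha> + \<theta>0)) = c"
      by blast
    have "y \<alpha> = c - \<i> * complex_of_real R * cis (\<alpha> + \<theta>0)" for \<alpha>
      unfolding c[OF UNIV_I[of \<alpha>], symmetric] by simp
    then show ?R by blast
  next
    assume ?R
    then obtain c where "\<And>\<alpha>. y \<alpha> = c - \<i> * complex_of_real R * cis (\<alpha> + \<theta>0)"
      by blast
    then have y: "y = (\<lambda>\<alpha>. c - \<i> * complex_of_real R * cis (\<alpha> + \<theta>0))"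
      by blast
    have "cis (\<alpha> + 2 * pi + \<theta>0) = cis (\<alpha> + \<theta>0)" for \<alpha>
      by (simp flip: cis_mult)
    then show ?L
      unfolding periodic_2pi_def y using circle_parametrization_derivative by simp
  qed
  then show ?thesis
    unfolding closed_contour_def unit_tangent_def by simp
qed

text \<open>
  The centre of the circle at time \<open>t\<close> is fixed up to a constant by its derivative \<open>\<i> * A\<^sub>\<rho>\<close>. That
  one constant serves all times because \<open>J\<close> is an interval.
\<close>

lemma translating_circle_iff:
  assumes "is_interval J" and "R \<noteq> 0"
    and vort: "\<And>t. t \<in> J \<Longrightarrow> is_vorticity A\<^sub>\<mu> A\<^sub>\<sigma> A\<^sub>\<rho> (2 * pi * R) (\<lambda>_. \<theta>0) (\<omega> t)"
  shows "closed_contour J (\<lambda>t \<alpha>. \<theta>0) (\<lambda>t. 2 * pi * R) z \<and>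
      contour_equation J (\<lambda>t. A\<^sub>\<rho> * sin \<theta>0) (\<lambda>t \<alpha>. \<theta>0) (\<lambda>t. 2 * pi * R) \<omega> z \<longleftrightarrow>
    (\<exists>c. \<forall>t\<in>J. \<forall>\<alpha>. z t \<alpha> = c + \<i> * complex_of_real (A\<^sub>\<rho> * t) - \<i> * complex_of_real R * cis (\<alpha> + \<theta>0))"
    (is "?closed \<and> ?contour \<longleftrightarrow> ?circle")
proof -
  have contour: "?contour \<longleftrightarrow>
      (\<forall>t\<in>J. \<forall>\<alpha>. ((\<lambda>s. z s \<alpha>) has_vector_derivative \<i> * complex_of_real A\<^sub>\<rho>) (at t within J))"
    using assms(2) vort by (rule contour_equation_circle_iff)
  have lin: "((\<lambda>s. c + \<i> * complex_of_real (A\<^sub>\<rho> * s) - d) has_vector_derivative \<i> * complex_of_real A\<^sub>\<rho>) (at t within J)"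
    for c d t
    unfolding has_vector_derivative_complex_iff by (auto intro!: derivative_eq_intros)
  show ?thesis
  proof
    assume *: "?closed \<and> ?contour"
    have z: "z t \<alpha> = z t 0 + \<i> * complex_of_real R * cis \<theta>0 - \<i> * complex_of_real R * cis (\<alpha> + \<theta>0)"
      if t: "t \<in> J" for t \<alpha>
    proof -
      obtain d where d: "\<And>\<alpha>. z t \<alpha> = d - \<i> * complex_of_real R * cis (\<alpha> + \<theta>0)"
        using * t unfolding closed_contour_circle_iff by blast
      show ?thesis
        using d[of \<alpha>] d[of 0] by simp
    qed
    have "((\<lambda>s. z s 0) has_vector_derivative \<i> * complex_of_real A\<^sub>\<rho>) (at t within J)" if "t \<in> J" for t
      using * that unfolding contour by blast
    from has_vector_derivative_diff[OF this lin[of 0 0]]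
    have "((\<lambda>s. z s 0 - (0 + \<i> * complex_of_real (A\<^sub>\<rho> * s) - 0)) has_vector_derivative 0) (at t within J)"
      if "t \<in> J" for t
      using that by (simp only: diff_self)
    from has_vector_derivative_zero_constant[OF is_interval_convex[OF assms(1)] this]
    obtain c where c': "\<And>t. t \<in> J \<Longrightarrow> z t 0 - (0 + \<i> * complex_of_real (A\<^sub>\<rho> * t) - 0) = c"
      by blast
    have c: "z t 0 = c + \<i> * complex_of_real (A\<^sub>\<rho> * t)" if "t \<in> J" for t
      unfolding c'[OF that, symmetric] by simp
    have "z t \<alpha> = (c + \<i> * complex_of_real R * cis \<theta>0) + \<i> * complex_of_real (A\<^sub>\<rho> * t) - \<i> * complex_of_real R * cis (\<alpha> + \<theta>0)"
      if "t \<in> J" for t \<alpha>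
      using z[OF that, of \<alpha>] c[OF that] by simp
    then show ?circle by blast
  next
    assume ?circle
    then obtain c where c: "\<And>t \<alpha>. t \<in> J \<Longrightarrow>
        z t \<alpha> = c + \<i> * complex_of_real (A\<^sub>\<rho> * t) - \<i> * complex_of_real R * cis (\<alpha> + \<theta>0)"
      by blast
    have "((\<lambda>s. z s \<alpha>) has_vector_derivative \<i> * complex_of_real A\<^sub>\<rho>) (at t within J)" if "t \<in> J" for t \<alpha>
      by (rule has_vector_derivative_transform[OF that _ lin]) (rule c)
    then have ?contour
      unfolding contour by blast
    moreover have ?closed
      unfolding closed_contour_circle_iff using c by blast
    ultimately show "?closed \<and> ?contour" by blast
  qed
qed

lemma circle_parametrization_image:
  assumes "R > 0"
  shows "(\<lambda>\<alpha>. c - \<i> * complex_of_real R * cis (\<alpha> + \<theta>0)) ` {-pi..pi} = sphere c R"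
proof (intro equalityI subsetI)
  fix w assume "w \<in> (\<lambda>\<alpha>. c - \<i> * complex_of_real R * cis (\<alpha> + \<theta>0)) ` {-pi..pi}"
  then show "w \<in> sphere c R"
    using assms by (auto simp: dist_norm norm_mult)
next
  fix w assume "w \<in> sphere c R"
  then have "norm (w - c) = R"
    by (simp add: dist_norm norm_minus_commute)
  \<comment> \<open>Solving \<open>w = c - \<i> * R * cis (\<alpha> + \<theta>0)\<close> for \<open>R * cis \<alpha>\<close> gives the following value.\<close>
  define u where "u = \<i> * (w - c) * cis (- \<theta>0)"
  have u: "norm u = R"
    using \<open>norm (w - c) = R\<close> by (simp add: u_def norm_mult)
  have "u \<noteq> 0"
    using u assms by auto
  then have "complex_of_real R * cis (Arg u) = u"
    using u assms by (simp add: cis_Arg sgn_div_norm scaleR_conv_of_real)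
  then have "\<i> * complex_of_real R * cis (Arg u + \<theta>0) = \<i> * u * cis \<theta>0"
    by (simp add: mult.assoc flip: cis_mult)
  also have "\<dots> = - (w - c) * (cis (- \<theta>0) * cis \<theta>0)"
    by (simp add: u_def algebra_simps)
  also have "cis (- \<theta>0) * cis \<theta>0 = 1"
    unfolding cis_mult by simp
  finally have "w = c - \<i> * complex_of_real R * cis (Arg u + \<theta>0)"
    by simp
  moreover have "Arg u \<in> {-pi..pi}"
    using Arg_bounded[of u] by simp
  ultimately show "w \<in> (\<lambda>\<alpha>. c - \<i> * complex_of_real R * cis (\<alpha> + \<theta>0)) ` {-pi..pi}"
    by blast
qed

theorem proposition2p1:
  fixes R A\<^sub>\<mu> A\<^sub>\<sigma> A\<^sub>\<rho> \<theta>0 :: real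
    and J :: "real set"
    and \<theta> :: "real \<Rightarrow> real \<Rightarrow> real"
    and L T0 :: "real \<Rightarrow> real"
  assumes "R > 0" and "A\<^sub>\<mu> \<in> {-1..1}" and "A\<^sub>\<sigma> > 0"
    and "is_interval J"
    and "\<theta> = (\<lambda>t \<alpha>. \<theta>0)"
    and "L = (\<lambda>t. 2 * pi * R)"
    and "T0 = (\<lambda>t. A\<^sub>\<rho> * sin (mean_value (\<theta> t)))"
  shows "(\<exists>w. continuous_on UNIV w \<and> theta_L_solution J A\<^sub>\<mu> A\<^sub>\<sigma> A\<^sub>\<rho> T0 \<theta> L (\<lambda>t. w)) \<and>
    (\<forall>\<omega>. (\<forall>t\<in>J. is_vorticity A\<^sub>\<mu> A\<^sub>\<sigma> A\<^sub>\<rho> (L t) (\<theta> t) (\<omega> t)) \<longrightarrow>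
       theta_L_solution J A\<^sub>\<mu> A\<^sub>\<sigma> A\<^sub>\<rho> T0 \<theta> L \<omega> \<and>
       (\<forall>z. closed_contour J \<theta> L z \<and> contour_equation J T0 \<theta> L \<omega> z \<longleftrightarrow>
          (\<exists>c. \<forall>t\<in>J. \<forall>\<alpha>.
             z t \<alpha> = c + \<i> * complex_of_real (A\<^sub>\<rho> * t)
                       - \<i> * complex_of_real R * cis (\<alpha> + \<theta>0))) \<and>
       (\<forall>z. closed_contour J \<theta> L z \<and> contour_equation J T0 \<theta> L \<omega> z \<longrightarrow>
          (\<forall>t\<in>J. \<forall>\<alpha>. ((\<lambda>s. z s \<alpha>) has_vector_derivative \<i> * complex_of_real A\<^sub>\<rho>)
                        (at t within J)) \<and>
          (\<exists>c. \<forall>t\<in>J. z t ` {-pi..pi} = sphere (c + \<i> * complex_of_real (A\<^sub>\<rho> * t)) R)))"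
proof -
  have \<theta>: "\<theta> = (\<lambda>t \<alpha>. \<theta>0)" and L: "L = (\<lambda>t. 2 * pi * R)" and T0: "T0 = (\<lambda>t. A\<^sub>\<rho> * sin \<theta>0)"
    using assms by (simp_all add: mean_value_const)
  show ?thesis
    unfolding \<theta> L T0
  proof (intro conjI allI impI)
    have "continuous_on UNIV (\<lambda>\<alpha>. - 2 * A\<^sub>\<rho> * R * sin (\<alpha> + \<theta>0))"
      by (intro continuous_intros)
    then show "\<exists>w. continuous_on UNIV w \<and> theta_L_solution J A\<^sub>\<mu> A\<^sub>\<sigma> A\<^sub>\<rho> (\<lambda>t. A\<^sub>\<rho> * sin \<theta>0) (\<lambda>t \<alpha>. \<theta>0)
        (\<lambda>t. 2 * pi * R) (\<lambda>t. w)"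
      using theta_L_solution_circle[OF \<open>R > 0\<close> circle_sinusoidal_is_vorticity] by blast
  next
    fix \<omega> assume "\<forall>t\<in>J. is_vorticity A\<^sub>\<mu> A\<^sub>\<sigma> A\<^sub>\<rho> (2 * pi * R) (\<lambda>\<alpha>. \<theta>0) (\<omega> t)"
    then have vort: "\<And>t. t \<in> J \<Longrightarrow> is_vorticity A\<^sub>\<mu> A\<^sub>\<sigma> A\<^sub>\<rho> (2 * pi * R) (\<lambda>\<alpha>. \<theta>0) (\<omega> t)"
      by blast
    have "R \<noteq> 0" using \<open>R > 0\<close> by simp
    show circle_iff: "closed_contour J (\<lambda>t \<alpha>. \<theta>0) (\<lambda>t. 2 * pi * R) z \<and>
        contour_equation J (\<lambda>t. A\<^sub>\<rho> * sin \<theta>0) (\<lambda>t \<alpha>. \<theta>0) (\<lambda>t. 2 * pi * R) \<omega> z \<longleftrightarrow>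
        (\<exists>c. \<forall>t\<in>J. \<forall>\<alpha>. z t \<alpha> = c + \<i> * complex_of_real (A\<^sub>\<rho> * t) - \<i> * complex_of_real R * cis (\<alpha> + \<theta>0))" for z
      using \<open>is_interval J\<close> \<open>R \<noteq> 0\<close> vort by (rule translating_circle_iff)
    show "theta_L_solution J A\<^sub>\<mu> A\<^sub>\<sigma> A\<^sub>\<rho> (\<lambda>t. A\<^sub>\<rho> * sin \<theta>0) (\<lambda>t \<alpha>. \<theta>0) (\<lambda>t. 2 * pi * R) \<omega>"
      using \<open>R > 0\<close> vort by (rule theta_L_solution_circle)
    fix z
    assume z: "closed_contour J (\<lambda>t \<alpha>. \<theta>0) (\<lambda>t. 2 * pi * R) z \<and>
        contour_equation J (\<lambda>t. A\<^sub>\<rho> * sin \<theta>0) (\<lambda>t \<alpha>. \<theta>0) (\<lambda>t. 2 * pi * R) \<omega> z"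
    then show "\<forall>t\<in>J. \<forall>\<alpha>. ((\<lambda>s. z s \<alpha>) has_vector_derivative \<i> * complex_of_real A\<^sub>\<rho>) (at t within J)"
      using contour_equation_circle_iff[where \<omega> = \<omega>, OF \<open>R \<noteq> 0\<close> vort] by simp
    from z obtain c where c: "\<And>t \<alpha>. t \<in> J \<Longrightarrow>
        z t \<alpha> = c + \<i> * complex_of_real (A\<^sub>\<rho> * t) - \<i> * complex_of_real R * cis (\<alpha> + \<theta>0)"
      using circle_iff by blast
    have "z t ` {-pi..pi} = sphere (c + \<i> * complex_of_real (A\<^sub>\<rho> * t)) R" if "t \<in> J" for t
      using circle_parametrization_image[OF \<open>R > 0\<close>] c[OF that] by simp
    then show "\<exists>c. \<forall>t\<in>J. z t ` {-pi..pi} = sphere (c + \<i> * complex_of_real (A\<^sub>\<rho> * t)) R"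
      by blast
  qed
qed

end
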